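(* For every integer $n\ge 1$ and every integer $k$ with $0\le k\le n-1$, $$f_{n,k}=\sum_{m=0}^{k+1}(-1)^{k-m+1}\binom{n+1}{k-m+1}\sum_{j=0}^{\lfloor n/2\rfloor}(-1)^j\binom{\binom{m+1}{2}+j-1}{j}\binom{m}{n-2j}.$$
   Context: Let $S_n$ be the symmetric group on $[n]=\{1,\dots,n\}$ and $\mathscr{I}_n\subseteq S_n$ the set of involutions, i.e. permutations $\sigma$ with $\sigma^2=\mathrm{id}$ (the identity included). For $\sigma\in S_n$, $\mathrm{ris}(\sigma)$ is the number of rises of $\sigma$, i.e. the number of $i\in\{1,\dots,n-1\}$ with $\sigma(i)<\sigma(i+1)$, and $\mathrm{sgn}(\sigma)\in\{1,-1\}$ is the sign of $\sigma$. The signed Eulerian numbers on involutions $f_{n,k}$ are defined by $$F_n(t)=\sum_{\sigma\in\mathscr{I}_n}\mathrm{sgn}(\sigma)\,t^{\mathrm{ris}(\sigma)}=\sum_{k=0}^{n-1}f_{n,k}t^k .$$ Convention: $\binom{N+j-1}{j}$, for an integer $N\ge 0$, is the number of multisets of size $j$ from an $N$-element set; thus it equals $1$ when $j=0$ (also if $N=0$) and $0$ when $N=0$, $j\ge1$. Also $\binom{a}{b}=0$ for integers $b>a\ge0$. *)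

theory Defs
  imports "HOL-Combinatorics.Permutations" "HOL-Computational_Algebra.Polynomial"
begin

definition involutions :: "nat \<Rightarrow> (nat \<Rightarrow> nat) set" where
  "involutions n = {\<sigma>. \<sigma> permutes {1..n} \<and> \<sigma> \<circ> \<sigma> = id}"

definition ris :: "nat \<Rightarrow> (nat \<Rightarrow> nat) \<Rightarrow> nat" where
  "ris n \<sigma> = card {i \<in> {1..<n}. \<sigma> i < \<sigma> (i + 1)}"

definition signed_eulerian_inv_poly :: "nat \<Rightarrow> int poly" where
  "signed_eulerian_inv_poly n = (\<Sum>\<sigma>\<in>involutions n. monom (sign \<sigma>) (ris n \<sigma>))"

definition signed_eulerian_inv :: "nat \<Rightarrow> nat \<Rightarrow> int" where
  "signed_eulerian_inv n k = coeff (signed_eulerian_inv_poly n) k"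

end

theory Submission
  imports Defs "HOL-Library.Product_Lexorder" "HOL-Computational_Algebra.Formal_Power_Series"
begin

text \<open>
  The inner sum over \<open>j\<close> is a signed count of labelled involutions. Call \<open>(\<sigma>, s)\<close> a labelled
  involution if \<open>\<sigma>\<close> is an involution of \<open>1, \<dots>, n\<close> and \<open>s\<close> is a weakly increasing labelling of the
  positions by \<open>1, \<dots>, m\<close> that increases strictly at every rise of \<open>\<sigma>\<close>. They are counted with
  the sign of \<open>\<sigma>\<close> in two ways.

  For a fixed \<open>\<sigma>\<close>, the generating function in \<open>m\<close> of the number of labellings is
  \<open>X ^ (ris \<sigma> + 1) / (1 - X) ^ (n + 1)\<close> (lemma \<open>climbs_gf\<close>). Multiplication by \<open>(1 - X) ^ (n + 1)\<close>,
  which is the outer alternating sum over \<open>m\<close>, therefore leaves the polynomial whose coefficients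
  are the signed Eulerian numbers, shifted by one.

  For a fixed \<open>m\<close>, record the multiset of the pairs \<open>(s i, s (\<sigma> i))\<close>. Since \<open>\<sigma>\<close> is an involution,
  it is symmetric under exchange of the components. Since \<open>\<sigma>\<close> decreases on each block of constant
  label, the positions are sorted by their own label, then downwards by the label of their image; and
  positions that agree in both labels are mapped in reversed order onto those with the exchanged
  labels. So the multiset determines \<open>(\<sigma>, s)\<close>, and every symmetric multiset of size \<open>n\<close> occurs
  (lemmas \<open>inj_content\<close> and \<open>content_surj\<close>).

  The sign is visible in the multiset as well: the positions with both labels equal to \<open>p\<close> are
  permuted by a reversal, which has a fixed point exactly when their number is odd. So the number of
  fixed points of \<open>\<sigma>\<close> is the number of odd diagonal multiplicities (lemma \<open>sign_content\<close>). A symmetric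
  multiset amounts to the set of odd diagonal positions, of size \<open>n - 2 * j\<close>, and a multiset of \<open>j\<close>
  unordered pairs, repetition within a pair allowed; the sign is \<open>(- 1) ^ j\<close>. This gives the inner
  sum (lemma \<open>signed_symmetric_multisets\<close>).
\<close>

section \<open>The sign of an involution\<close>

text \<open>
  Composing with the transposition of a point and its image, when the two differ, splits off one
  2-cycle: two more points become fixed and the sign changes. Hence the sign counts 2-cycles, that
  is, half of the points that are not fixed.
\<close>

lemma sign_involution:
  assumes "finite A" "\<sigma> permutes A" "\<sigma> \<circ> \<sigma> = id"
  shows "sign \<sigma> = (- 1) ^ ((card A - card {x \<in> A. \<sigma> x = x}) div 2)"
proof -
  have moved: "sign \<sigma> = (- 1) ^ (card {x \<in> A. \<sigma> x \<noteq> x} div 2)"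
    using assms(2,3)
  proof (induction "card {x \<in> A. \<sigma> x \<noteq> x}" arbitrary: \<sigma> rule: less_induct)
    case less
    have inv: "\<sigma> (\<sigma> x) = x" for x
      using less.prems(2) by (metis comp_apply id_apply)
    show ?case
    proof (cases "\<exists>a\<in>A. \<sigma> a \<noteq> a")
      case False
      then have "\<sigma> = id"
        using less.prems(1) by (auto simp: permutes_def fun_eq_iff)
      then show ?thesis
        by simp
    next
      case True
      then obtain a where a: "a \<in> A" "\<sigma> a \<noteq> a"
        by blast
      let ?b = "\<sigma> a"
      have b: "?b \<in> A" "\<sigma> ?b = a"
        using permutes_in_image[OF less.prems(1)] a(1) inv by auto
      define \<tau> where "\<tau> = transpose a ?b \<circ> \<sigma>"
      have \<tau>_simps: "\<tau> x = (if x = a \<or> x = ?b then x else \<sigma> x)" for x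
        unfolding \<tau>_def comp_apply using a(2) inv
        by (smt (verit, best) transpose_apply_first transpose_apply_second transpose_apply_other)
      have \<tau>: "\<tau> permutes A"
        unfolding \<tau>_def using less.prems(1) a(1) b(1) by (intro permutes_compose permutes_swap_id)
      have \<tau>_inv: "\<tau> \<circ> \<tau> = id"
        using inv by (simp add: fun_eq_iff \<tau>_simps) metis
      have split: "{x \<in> A. \<sigma> x \<noteq> x} = insert a (insert ?b {x \<in> A. \<tau> x \<noteq> x})"
        using a b by (auto simp: \<tau>_simps)
      have card: "card {x \<in> A. \<sigma> x \<noteq> x} = card {x \<in> A. \<tau> x \<noteq> x} + 2"
        unfolding split using assms(1) a(2) by (subst card_insert_disjoint; auto simp: \<tau>_simps)+
      have "\<sigma> = transpose a ?b \<circ> \<tau>"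
        by (simp add: \<tau>_def fun_eq_iff)
      then have "sign \<sigma> = sign (transpose a ?b) * sign \<tau>"
        using permutes_imp_permutation[OF assms(1) \<tau>] permutation_swap_id
        by (metis sign_compose)
      also have "sign \<tau> = (- 1) ^ (card {x \<in> A. \<tau> x \<noteq> x} div 2)"
        using card by (intro less.hyps \<tau> \<tau>_inv) simp
      finally show ?thesis
        using a(2) by (simp add: sign_swap_id card)
    qed
  qed
  have "{x \<in> A. \<sigma> x \<noteq> x} = A - {x \<in> A. \<sigma> x = x}"
    by blast
  then have "card {x \<in> A. \<sigma> x \<noteq> x} = card A - card {x \<in> A. \<sigma> x = x}"
    using assms(1) by (simp add: card_Diff_subset)
  with moved show ?thesis
    by simp
qed

section \<open>Sequences that must increase at prescribed places\<close>

text \<open>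
  The places \<open>R\<close> of prescribed strict increase are going to be the rises of an involution. The
  sequences are extensional functions, so that there are only finitely many of them.
\<close>

definition climbs :: "(nat \<Rightarrow> bool) \<Rightarrow> nat \<Rightarrow> nat \<Rightarrow> (nat \<Rightarrow> nat) set" where
  "climbs R n m =
    {s \<in> {1..n} \<rightarrow>\<^sub>E {1..m}. \<forall>i\<in>{1..<n}. s i \<le> s (i + 1) \<and> (R i \<longrightarrow> s i < s (i + 1))}"

lemma finite_climbs: "finite (climbs R n m)"
proof (rule finite_subset)
  show "climbs R n m \<subseteq> {1..n} \<rightarrow>\<^sub>E {1..m}"
    by (auto simp: climbs_def)
qed (simp add: finite_PiE)

lemma climbs_mono:
  assumes "s \<in> climbs R n m" "1 \<le> i" "i \<le> j" "j \<le> n"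
  shows "s i \<le> s j"
  using assms(3,4)
proof (induction j rule: dec_induct)
  case (step j)
  then have "s j \<le> s (j + 1)"
    using assms(1,2) by (auto simp: climbs_def)
  with step show ?case
    by simp
qed simp

text \<open>
  A sequence either avoids the top value \<open>Suc m\<close> or ends in it. In the second case the last entry
  can be deleted, and what remains is an arbitrary shorter sequence, with values up to \<open>m\<close> if \<open>R n\<close>
  demands a strict increase and up to \<open>Suc m\<close> otherwise.
\<close>

lemma card_climbs_Suc:
  assumes "n \<ge> 1"
  shows "card (climbs R (Suc n) (Suc m)) =
    card (climbs R (Suc n) m) + card (climbs R n (if R n then m else Suc m))"
proof -
  let ?v = "if R n then m else Suc m"
  let ?top = "{s \<in> climbs R (Suc n) (Suc m). s (Suc n) = Suc m}"
  let ?ext = "\<lambda>s. s(Suc n := Suc m)"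
  have "climbs R (Suc n) m \<subseteq> climbs R (Suc n) (Suc m)"
    by (fastforce simp: climbs_def PiE_iff)
  moreover have "s \<in> climbs R (Suc n) m"
    if s: "s \<in> climbs R (Suc n) (Suc m)" "s (Suc n) \<noteq> Suc m" for s
  proof -
    have "s (Suc n) \<le> m"
      using s PiE_mem[of s "{1..Suc n}" "\<lambda>_. {1..Suc m}" "Suc n"] by (simp add: climbs_def)
    then have "s i \<le> m" if "i \<in> {1..Suc n}" for i
      using climbs_mono[OF s(1), of i "Suc n"] that by auto
    then show ?thesis
      using s(1) by (auto simp: climbs_def PiE_iff)
  qed
  moreover have "s (Suc n) \<noteq> Suc m" if "s \<in> climbs R (Suc n) m" for s
  proof -
    have "s (Suc n) \<in> {1..m}"
      using that by (simp add: climbs_def PiE_iff)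
    then show ?thesis by auto
  qed
  ultimately have split: "climbs R (Suc n) (Suc m) = climbs R (Suc n) m \<union> ?top"
    and disj: "climbs R (Suc n) m \<inter> ?top = {}"
    by auto
  have "bij_betw ?ext (climbs R n ?v) ?top"
  proof (rule bij_betw_byWitness[where f' = "\<lambda>s. restrict s {1..n}"])
    show "\<forall>s\<in>climbs R n ?v. restrict (?ext s) {1..n} = s"
      by (auto simp: climbs_def PiE_iff extensional_def fun_eq_iff)
    show "\<forall>s\<in>?top. ?ext (restrict s {1..n}) = s"
      by (auto simp: climbs_def PiE_iff extensional_def fun_eq_iff)
    show "?ext ` climbs R n ?v \<subseteq> ?top"
    proof (rule image_subsetI)
      fix s assume s: "s \<in> climbs R n ?v"
      have le: "s i \<le> ?v" "1 \<le> s i" if "i \<in> {1..n}" for i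
        using s that by (auto simp: climbs_def PiE_iff)
      have "?ext s \<in> {1..Suc n} \<rightarrow>\<^sub>E {1..Suc m}"
      proof (rule PiE_I)
        fix i assume "i \<in> {1..Suc n}"
        then show "?ext s i \<in> {1..Suc m}"
          using le[of i] by (cases "i = Suc n") (auto split: if_splits)
      next
        fix i assume "i \<notin> {1..Suc n}"
        then show "?ext s i = undefined"
          using s by (auto simp: climbs_def PiE_iff extensional_def)
      qed
      moreover have "?ext s i \<le> ?ext s (i + 1) \<and> (R i \<longrightarrow> ?ext s i < ?ext s (i + 1))"
        if "i \<in> {1..<Suc n}" for i
      proof (cases "i = n")
        case True
        then show ?thesis
          using le[of n] assms by (auto split: if_splits)
      next
        case False
        then show ?thesis
          using s that by (auto simp: climbs_def)
      qed
      ultimately show "?ext s \<in> ?top"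
        by (simp add: climbs_def)
    qed
    show "(\<lambda>s. restrict s {1..n}) ` ?top \<subseteq> climbs R n ?v"
    proof (rule image_subsetI)
      fix s assume s: "s \<in> ?top"
      have top: "s n \<le> ?v"
        using s assms by (auto simp: climbs_def dest!: bspec[of _ _ n])
      have "s i \<in> {1..?v}" if "i \<in> {1..n}" for i
      proof -
        have "s i \<le> s n"
          using s that by (intro climbs_mono[of s R "Suc n" "Suc m"]) auto
        moreover have "1 \<le> s i"
          using s that by (auto simp: climbs_def PiE_iff)
        ultimately show ?thesis
          using top by simp
      qed
      then show "restrict s {1..n} \<in> climbs R n ?v"
        using s by (auto simp: climbs_def)
    qed
  qed
  from bij_betw_same_card[OF this] have top: "card ?top = card (climbs R n ?v)"
    by (rule sym)
  have "card (climbs R (Suc n) (Suc m)) = card (climbs R (Suc n) m \<union> ?top)"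
    using split by (rule arg_cong)
  also have "\<dots> = card (climbs R (Suc n) m) + card ?top"
    by (intro card_Un_disjoint disj finite_climbs finite_Collect_conjI disjI1)
       (simp add: finite_climbs)
  finally show ?thesis
    unfolding top .
qed

text \<open>
  The recursion above says that multiplication by \<open>1 - X\<close> removes the last position, at the cost of
  a factor \<open>X\<close> when a strict increase is demanded there. At \<open>n = 1\<close> the series is
  \<open>X / (1 - X)\<^sup>2\<close>; its numerator is the source of the extra factor \<open>X\<close>.
\<close>

lemma climbs_gf:
  assumes "n \<ge> 1"
  shows "(1 - fps_X) ^ (n + 1) * Abs_fps (\<lambda>m. int (card (climbs R n m))) =
    fps_X ^ (card {i \<in> {1..<n}. R i} + 1)"
  using assms
proof (induction n rule: dec_induct)
  case base
  have "card (climbs R 1 m) = m" for m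
  proof -
    have "climbs R 1 m = {1} \<rightarrow>\<^sub>E {1..m}"
      by (auto simp: climbs_def)
    then show ?thesis
      by (simp add: card_PiE)
  qed
  moreover have "(1 - fps_X) * Abs_fps int = Abs_fps (\<lambda>m. of_bool (m > 0))"
    by (auto simp: fps_eq_iff left_diff_distrib of_nat_diff)
  moreover have "(1 - fps_X) * Abs_fps (\<lambda>m. of_bool (m > 0)) = (fps_X :: int fps)"
    by (auto simp: fps_eq_iff left_diff_distrib)
  ultimately show ?case
    by (simp add: power2_eq_square mult.assoc)
next
  case (step n)
  let ?C = "\<lambda>n. Abs_fps (\<lambda>m. int (card (climbs R n m)))"
  have zero: "card (climbs R n 0) = 0" if "n \<ge> 1" for n
  proof -
    have "climbs R n 0 = {}"
      using that by (auto simp: climbs_def PiE_iff)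
    then show ?thesis by simp
  qed
  have "(1 - fps_X) * ?C (Suc n) = (if R n then fps_X else 1) * ?C n"
  proof (rule fps_ext)
    fix m
    show "fps_nth ((1 - fps_X) * ?C (Suc n)) m = fps_nth ((if R n then fps_X else 1) * ?C n) m"
      using step.hyps by (cases m) (auto simp: left_diff_distrib zero card_climbs_Suc)
  qed
  then have "(1 - fps_X) ^ (Suc n + 1) * ?C (Suc n) =
      (if R n then fps_X else 1) * ((1 - fps_X) ^ (n + 1) * ?C n)"
    by (metis (no_types, lifting) Suc_eq_plus1 mult.assoc mult.left_commute power_Suc2)
  also have "\<dots> = (if R n then fps_X else 1) * fps_X ^ (card {i \<in> {1..<n}. R i} + 1)"
    by (simp only: step.IH)
  also have "\<dots> = fps_X ^ (card {i \<in> {1..<Suc n}. R i} + 1)"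
  proof (cases "R n")
    case True
    then have "{i \<in> {1..<Suc n}. R i} = insert n {i \<in> {1..<n}. R i}"
      using step.hyps by auto
    then show ?thesis
      using True by simp
  next
    case False
    then have "{i \<in> {1..<Suc n}. R i} = {i \<in> {1..<n}. R i}"
      by (auto simp: less_Suc_eq)
    then show ?thesis
      using False by simp
  qed
  finally show ?case .
qed

section \<open>Enumerating a finite linear order\<close>

(* Keeps the intervals {1..n} in the form in which they occur in the lemmas below. *)
declare One_nat_def [simp del]

lemma ex_enumeration:
  fixes X :: "'a::linorder set"
  assumes "finite X"
  obtains g where "bij_betw g {1..card X} X" "strict_mono_on {1..card X} g"
proof
  let ?xs = "sorted_list_of_set X"
  let ?g = "\<lambda>i. ?xs ! (i - 1)"
  show "strict_mono_on {1..card X} ?g"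
    by (intro strict_mono_onI sorted_wrt_nth_less[of "(<)"]) auto
  then have "inj_on ?g {1..card X}"
    by (rule strict_mono_on_imp_inj_on)
  moreover have "?g ` {1..card X} \<subseteq> X"
    using set_sorted_list_of_set[OF assms] nth_mem[of _ ?xs] by fastforce
  ultimately show "bij_betw ?g {1..card X} X"
    using card_image[of ?g "{1..card X}"] by (intro bij_betw_imageI card_subset_eq assms) simp_all
qed

lemma enumeration_unique:
  fixes g h :: "nat \<Rightarrow> 'a::linorder"
  assumes "strict_mono_on {1..n} g" "strict_mono_on {1..n} h"
    and "g ` {1..n} = h ` {1..n}" and "i \<in> {1..n}"
  shows "g i = h i"
proof -
  have sorted: "sorted_wrt (<) (map f [1..<Suc n])" if "strict_mono_on {1..n} f" for f :: "nat \<Rightarrow> 'a"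
    unfolding sorted_wrt_map
    by (rule sorted_wrt_mono_rel[OF _ sorted_wrt_upt]) (auto intro: strict_mono_onD[OF that])
  have "map g [1..<Suc n] = map h [1..<Suc n]"
    by (rule strict_sorted_equal[OF sorted sorted])
       (use assms in \<open>simp_all del: upt_Suc add: atLeastLessThanSuc_atLeastAtMost\<close>)
  then show ?thesis
    using assms(4) by (simp del: upt_Suc)
qed

section \<open>Letters\<close>

text \<open>
  A labelled involution \<open>(\<sigma>, s)\<close> is turned into a word of letters: position \<open>i\<close> carries
  \<open>(s i, - s (\<sigma> i), e)\<close>, where \<open>e\<close> distinguishes the positions with the same two labels. The
  second component is negated because \<open>\<sigma>\<close> decreases along each block of constant \<open>s\<close>; with this sign
  the word is strictly increasing in the lexicographic order.
\<close>

type_synonym letter = "int \<times> int \<times> int"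

text \<open>
  The action of \<open>\<sigma>\<close> on letters: it exchanges the two labels and reverses the order of the letters
  that share both labels.
\<close>

fun opposite :: "letter \<Rightarrow> letter" where
  "opposite (x, y, e) = (- y, - x, - e)"

lemma opposite_opposite [simp]: "opposite (opposite x) = x"
  by (cases x) simp

lemma opposite_antimono: "x < y \<Longrightarrow> fst x = fst y \<Longrightarrow> opposite y < opposite x"
  by (cases x; cases y) auto

text \<open>
  The letters with labels \<open>p\<close> and \<open>q\<close> are numbered \<open>1 - a, 3 - a, \<dots>, a - 1\<close>, where \<open>a\<close> is the
  multiplicity of \<open>(p, q)\<close>. These numbers are symmetric about 0, which makes the letters of a
  symmetric multiset closed under \<open>opposite\<close>.
\<close>

definition letter :: "(nat \<times> nat) multiset \<Rightarrow> (nat \<times> nat) \<times> nat \<Rightarrow> letter" where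
  "letter A = (\<lambda>((p, q), r). (int p, - int q, 2 * int r + 1 - int (count A (p, q))))"

definition letters :: "(nat \<times> nat) multiset \<Rightarrow> letter set" where
  "letters A = letter A ` (SIGMA x:set_mset A. {..<count A x})"

lemma mem_letters_iff:
  "(x, y, e) \<in> letters A \<longleftrightarrow> (\<exists>p q r. x = int p \<and> y = - int q \<and>
     r < count A (p, q) \<and> e = 2 * int r + 1 - int (count A (p, q)))"
proof -
  have "(p, q) \<in># A" if "r < count A (p, q)" for p q r
    using that by (simp flip: count_greater_zero_iff)
  then show ?thesis
    unfolding letters_def letter_def by (force simp: image_iff Bex_def)
qed

lemma inj_letter: "inj_on (letter A) B"
  by (auto simp: inj_on_def letter_def)

lemma finite_letters [simp]: "finite (letters A)"
  by (simp add: letters_def)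

lemma card_letters: "card (letters A) = size A"
  by (simp add: letters_def card_image inj_letter size_multiset_overloaded_eq)

definition symmetric :: "('a \<times> 'a) multiset \<Rightarrow> bool" where
  "symmetric A \<longleftrightarrow> (\<forall>p q. count A (p, q) = count A (q, p))"

lemma opposite_letters:
  assumes "symmetric A" "x \<in> letters A"
  shows "opposite x \<in> letters A"
proof -
  obtain p q r where x: "x = (int p, - int q, 2 * int r + 1 - int (count A (p, q)))"
    and r: "r < count A (p, q)"
    using assms(2) by (cases x) (auto simp: mem_letters_iff)
  have sym: "count A (q, p) = count A (p, q)"
    using assms(1) by (simp add: symmetric_def)
  let ?r = "count A (p, q) - 1 - r"
  have "?r < count A (q, p) \<and> - (2 * int r + 1 - int (count A (p, q))) = 2 * int ?r + 1 - int (count A (q, p))"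
    using r sym by (auto simp: of_nat_diff)
  then show ?thesis
    unfolding x by (auto simp: mem_letters_iff)
qed

text \<open>
  A letter equals its opposite only if its two labels agree and its number is 0, and 0 occurs among
  \<open>1 - a, 3 - a, \<dots>, a - 1\<close> precisely when \<open>a\<close> is odd.
\<close>

lemma card_fixed_letters:
  assumes "set_mset A \<subseteq> P \<times> P"
  shows "card {x \<in> letters A. opposite x = x} = card {p \<in> P. odd (count A (p, p))}"
proof -
  have "bij_betw (\<lambda>p. (int p, - int p, 0)) {p \<in> P. odd (count A (p, p))} {x \<in> letters A. opposite x = x}"
  proof (rule bij_betw_imageI)
    show "(\<lambda>p. (int p, - int p, 0)) ` {p \<in> P. odd (count A (p, p))} = {x \<in> letters A. opposite x = x}"
    proof (intro equalityI image_subsetI subsetI)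
      fix p assume p: "p \<in> {p \<in> P. odd (count A (p, p))}"
      then obtain r where "count A (p, p) = 2 * r + 1"
        by (auto elim: oddE)
      then show "(int p, - int p, 0) \<in> {x \<in> letters A. opposite x = x}"
        by (auto simp: mem_letters_iff intro!: exI[of _ r])
    next
      fix x assume x: "x \<in> {x \<in> letters A. opposite x = x}"
      obtain p q r where pqr: "x = (int p, - int q, 2 * int r + 1 - int (count A (p, q)))"
        "r < count A (p, q)"
        using x by (cases x) (auto simp: mem_letters_iff)
      have q: "q = p" and e: "2 * int r + 1 - int (count A (p, q)) = 0"
      proof -
        have "opposite x = x"
          using x by simp
        then show "q = p" "2 * int r + 1 - int (count A (p, q)) = 0"
          unfolding pqr(1) opposite.simps prod.inject by linarith+
      qed
      have "count A (p, p) = 2 * r + 1"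
        using e unfolding q by linarith
      moreover have "p \<in> P"
        using pqr(2) q assms by (metis count_greater_zero_iff gr_zeroI mem_Sigma_iff not_less0 subsetD)
      ultimately have "p \<in> {p \<in> P. odd (count A (p, p))}"
        by simp
      moreover have "x = (int p, - int p, 0)"
        unfolding pqr(1) e using q by simp
      ultimately show "x \<in> (\<lambda>p. (int p, - int p, 0)) ` {p \<in> P. odd (count A (p, p))}"
        by (rule rev_image_eqI)
    qed
  qed (auto simp: inj_on_def)
  from bij_betw_same_card[OF this] show ?thesis
    by (rule sym)
qed

section \<open>Labelled involutions and symmetric multisets\<close>

definition content :: "nat \<Rightarrow> (nat \<Rightarrow> nat) \<times> (nat \<Rightarrow> nat) \<Rightarrow> (nat \<times> nat) multiset" where
  "content n = (\<lambda>(\<sigma>, s). image_mset (\<lambda>i. (s i, s (\<sigma> i))) (mset_set {1..n}))"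

lemma count_content:
  "count (content n (\<sigma>, s)) (p, q) = card {i \<in> {1..n}. s i = p \<and> s (\<sigma> i) = q}"
proof -
  have "count (content n (\<sigma>, s)) (p, q) = size {#i \<in># mset_set {1..n}. (p, q) = (s i, s (\<sigma> i))#}"
    unfolding content_def by (simp add: count_image_mset')
  also have "\<dots> = card {i \<in> {1..n}. (p, q) = (s i, s (\<sigma> i))}"
    by (simp add: filter_mset_mset_set)
  also have "{i \<in> {1..n}. (p, q) = (s i, s (\<sigma> i))} = {i \<in> {1..n}. s i = p \<and> s (\<sigma> i) = q}"
    by auto
  finally show ?thesis .
qed

definition labelled_involutions :: "nat \<Rightarrow> nat \<Rightarrow> ((nat \<Rightarrow> nat) \<times> (nat \<Rightarrow> nat)) set" where
  "labelled_involutions n m = (SIGMA \<sigma>:involutions n. climbs (\<lambda>i. \<sigma> i < \<sigma> (i + 1)) n m)"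

definition symmetric_multisets :: "nat \<Rightarrow> nat \<Rightarrow> (nat \<times> nat) multiset set" where
  "symmetric_multisets n m = {A \<in> multisets_of_size ({1..m} \<times> {1..m}) n. symmetric A}"

text \<open>
  In this locale a fixed labelled involution is shown to be the increasing enumeration of the letters
  of its content, with \<open>\<sigma>\<close> acting as \<open>opposite\<close>.
\<close>

locale labelled_involution =
  fixes n m :: nat and \<sigma> s :: "nat \<Rightarrow> nat"
  assumes labelled: "(\<sigma>, s) \<in> labelled_involutions n m"
begin

lemma permutes: "\<sigma> permutes {1..n}"
  and inv [simp]: "\<sigma> (\<sigma> i) = i"
  using labelled by (auto simp: labelled_involutions_def involutions_def fun_eq_iff)

lemma in_range_iff [simp]: "\<sigma> i \<in> {1..n} \<longleftrightarrow> i \<in> {1..n}"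
  by (rule permutes_in_image[OF permutes])

lemma range: "i \<in> {1..n} \<Longrightarrow> s i \<in> {1..m}"
  using labelled by (auto simp: labelled_involutions_def climbs_def PiE_iff)

lemma s_mono: "1 \<le> i \<Longrightarrow> i \<le> j \<Longrightarrow> j \<le> n \<Longrightarrow> s i \<le> s j"
  using labelled by (auto simp: labelled_involutions_def intro: climbs_mono)

text \<open>
  A block of constant label contains no strict increase of \<open>s\<close>, hence no rise of \<open>\<sigma>\<close>.
\<close>

lemma \<sigma>_antimono:
  assumes "1 \<le> i" "i < j" "j \<le> n" "s i = s j"
  shows "\<sigma> j < \<sigma> i"
proof -
  have "i + 1 \<le> j"
    using assms(2) by simp
  then show ?thesis
    using assms(3,4)
  proof (induction j rule: dec_induct)
    case base
    then have "\<not> \<sigma> i < \<sigma> (i + 1)"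
      using labelled assms(1) by (auto simp: labelled_involutions_def climbs_def)
    moreover have "\<sigma> i \<noteq> \<sigma> (i + 1)"
      by (metis inv n_not_Suc_n Suc_eq_plus1)
    ultimately show ?case
      by simp
  next
    case (step j)
    have "s i \<le> s j" "s j \<le> s (Suc j)"
      using assms(1) step.hyps step.prems(1) by (intro s_mono; simp)+
    then have eq: "s i = s j" "s j = s (j + 1)"
      using step.prems(2) unfolding Suc_eq_plus1 by linarith+
    then have "\<sigma> j < \<sigma> i"
      using step.IH step.prems(1) by simp
    moreover have "\<not> \<sigma> j < \<sigma> (j + 1)"
      using labelled step eq assms(1) by (auto simp: labelled_involutions_def climbs_def)
    ultimately show ?case
      unfolding Suc_eq_plus1 by linarith
  qed
qed

lemma \<sigma>_less_iff:
  assumes "i \<in> {1..n}" "j \<in> {1..n}" "s i = s j"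
  shows "\<sigma> i < \<sigma> j \<longleftrightarrow> j < i"
  using \<sigma>_antimono[of i j] \<sigma>_antimono[of j i] assms by (cases i j rule: linorder_cases) auto

definition fibre :: "nat \<Rightarrow> nat set" where
  "fibre i = {j \<in> {1..n}. s j = s i \<and> s (\<sigma> j) = s (\<sigma> i)}"

definition below :: "nat \<Rightarrow> nat" where
  "below i = card {j \<in> fibre i. j < i}"

definition above :: "nat \<Rightarrow> nat" where
  "above i = card {j \<in> fibre i. i < j}"

text \<open>
  In a fibre of size \<open>a\<close> the difference \<open>below - above\<close> runs through \<open>1 - a, 3 - a, \<dots>, a - 1\<close>, so
  these are letters of the content.
\<close>

definition letter_of :: "nat \<Rightarrow> letter" where
  "letter_of i = (int (s i), - int (s (\<sigma> i)), int (below i) - int (above i))"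

lemma finite_fibre [simp]: "finite (fibre i)"
  by (simp add: fibre_def)

text \<open>
  The involution maps the fibre of \<open>i\<close> onto the fibre of \<open>\<sigma> i\<close> and reverses its order.
\<close>

lemma below_\<sigma>:
  assumes "i \<in> {1..n}"
  shows "below (\<sigma> i) = above i"
proof -
  have "bij_betw \<sigma> {j \<in> fibre i. i < j} {j \<in> fibre (\<sigma> i). j < \<sigma> i}"
  proof (rule bij_betw_byWitness[where f' = \<sigma>])
    show "\<sigma> ` {j \<in> fibre i. i < j} \<subseteq> {j \<in> fibre (\<sigma> i). j < \<sigma> i}"
      using assms \<sigma>_less_iff by (auto simp: fibre_def simp del: atLeastAtMost_iff)
    show "\<sigma> ` {j \<in> fibre (\<sigma> i). j < \<sigma> i} \<subseteq> {j \<in> fibre i. i < j}"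
    proof (rule image_subsetI)
      fix j assume "j \<in> {j \<in> fibre (\<sigma> i). j < \<sigma> i}"
      then show "\<sigma> j \<in> {j \<in> fibre i. i < j}"
        using assms \<sigma>_less_iff[of "\<sigma> i" j] by (auto simp: fibre_def simp del: atLeastAtMost_iff)
    qed
  qed auto
  from bij_betw_same_card[OF this] show ?thesis
    by (simp add: below_def above_def)
qed

lemma opposite_letter_of: "i \<in> {1..n} \<Longrightarrow> opposite (letter_of i) = letter_of (\<sigma> i)"
  using below_\<sigma>[of i] below_\<sigma>[of "\<sigma> i"] by (simp add: letter_of_def del: atLeastAtMost_iff)

lemma letter_of_strict_mono: "strict_mono_on {1..n} letter_of"
proof (rule strict_mono_onI)
  fix i j assume ij: "i \<in> {1..n}" "j \<in> {1..n}" "i < j"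
  have "s i \<le> s j"
    using ij s_mono by simp
  moreover have "s (\<sigma> j) \<le> s (\<sigma> i)" if "s i = s j"
    using \<sigma>_antimono[of i j] ij that in_range_iff[of i] in_range_iff[of j]
    by (intro s_mono) auto
  moreover have "below i < below j \<and> above j < above i" if "s i = s j" "s (\<sigma> i) = s (\<sigma> j)"
  proof -
    have eq: "fibre i = fibre j" and mem: "i \<in> fibre i" "j \<in> fibre i"
      using ij that by (auto simp: fibre_def)
    have "{k \<in> fibre i. k < i} \<subset> {k \<in> fibre j. k < j}" "{k \<in> fibre j. j < k} \<subset> {k \<in> fibre i. i < k}"
      using ij mem unfolding eq by auto
    then show ?thesis
      by (simp add: below_def above_def psubset_card_mono)
  qed
  ultimately show "letter_of i < letter_of j"
    by (fastforce simp: letter_of_def)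
qed

lemma set_content: "set_mset (content n (\<sigma>, s)) \<subseteq> {1..m} \<times> {1..m}"
  using range by (auto simp: content_def simp del: atLeastAtMost_iff)

lemma size_content: "size (content n (\<sigma>, s)) = n"
  by (simp add: content_def)

lemma symmetric_content: "symmetric (content n (\<sigma>, s))"
  unfolding symmetric_def count_content
proof (intro allI)
  fix p q
  have "bij_betw \<sigma> {i \<in> {1..n}. s i = p \<and> s (\<sigma> i) = q} {i \<in> {1..n}. s i = q \<and> s (\<sigma> i) = p}"
    by (rule bij_betw_byWitness[where f' = \<sigma>]) (auto simp del: atLeastAtMost_iff)
  then show "card {i \<in> {1..n}. s i = p \<and> s (\<sigma> i) = q} = card {i \<in> {1..n}. s i = q \<and> s (\<sigma> i) = p}"
    by (rule bij_betw_same_card)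
qed

lemma content_symmetric_multisets: "content n (\<sigma>, s) \<in> symmetric_multisets n m"
  using set_content size_content symmetric_content
  by (simp add: symmetric_multisets_def multisets_of_size_def)

lemma letter_of_image: "letter_of ` {1..n} = letters (content n (\<sigma>, s))"
proof (rule card_subset_eq)
  show "letter_of ` {1..n} \<subseteq> letters (content n (\<sigma>, s))"
  proof (rule image_subsetI)
    fix i assume i: "i \<in> {1..n}"
    have "fibre i = insert i ({j \<in> fibre i. j < i} \<union> {j \<in> fibre i. i < j})"
      using i by (auto simp: fibre_def)
    then have "card (fibre i) = card (insert i ({j \<in> fibre i. j < i} \<union> {j \<in> fibre i. i < j}))"
      by (rule arg_cong)
    also have "\<dots> = Suc (below i + above i)"
      unfolding below_def above_def by (subst card_insert_disjoint card_Un_disjoint; auto)+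
    finally have "card (fibre i) = Suc (below i + above i)" .
    moreover have "count (content n (\<sigma>, s)) (s i, s (\<sigma> i)) = card (fibre i)"
      by (simp add: count_content fibre_def)
    ultimately show "letter_of i \<in> letters (content n (\<sigma>, s))"
      by (auto simp: letter_of_def mem_letters_iff intro!: exI[of _ "below i"])
  qed
  show "card (letter_of ` {1..n}) = card (letters (content n (\<sigma>, s)))"
    using strict_mono_on_imp_inj_on[OF letter_of_strict_mono]
    by (simp add: card_image card_letters size_content)
qed simp

lemma letter_of_bij: "bij_betw letter_of {1..n} (letters (content n (\<sigma>, s)))"
  using strict_mono_on_imp_inj_on[OF letter_of_strict_mono] letter_of_image by (rule bij_betw_imageI)

text \<open>
  The fixed points of \<open>\<sigma>\<close> are the positions whose letter is its own opposite.
\<close>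

lemma sign_content:
  "sign \<sigma> = (- 1) ^ ((n - card {p \<in> {1..m}. odd (count (content n (\<sigma>, s)) (p, p))}) div 2)"
proof -
  have "bij_betw letter_of {i \<in> {1..n}. \<sigma> i = i} {x \<in> letters (content n (\<sigma>, s)). opposite x = x}"
  proof (rule bij_betw_subset[OF letter_of_bij, THEN bij_betw_cong[THEN iffD1, rotated]])
    show "letter_of ` {i \<in> {1..n}. \<sigma> i = i} = {x \<in> letters (content n (\<sigma>, s)). opposite x = x}"
    proof -
      have "letter_of (\<sigma> i) = letter_of i \<longleftrightarrow> \<sigma> i = i" if "i \<in> {1..n}" for i
        using inj_on_eq_iff[OF bij_betw_imp_inj_on[OF letter_of_bij], of "\<sigma> i" i] that
        by (simp del: atLeastAtMost_iff)
      then show ?thesis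
        unfolding letter_of_image[symmetric]
        by (auto simp: opposite_letter_of simp del: atLeastAtMost_iff)
    qed
  qed auto
  then have "card {i \<in> {1..n}. \<sigma> i = i} = card {x \<in> letters (content n (\<sigma>, s)). opposite x = x}"
    by (rule bij_betw_same_card)
  also have "\<dots> = card {p \<in> {1..m}. odd (count (content n (\<sigma>, s)) (p, p))}"
    by (rule card_fixed_letters[OF set_content])
  finally show ?thesis
    using sign_involution[of "{1..n}" \<sigma>] permutes by (simp add: fun_eq_iff)
qed

end

text \<open>
  The content determines the set of letters, a finite linear order has only one increasing
  enumeration, and from it \<open>s\<close> is read off as the first component and \<open>\<sigma>\<close> as the action of
  \<open>opposite\<close>.
\<close>

lemma inj_content: "inj_on (content n) (labelled_involutions n m)"
proof (rule inj_onI)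
  fix u v
  assume u: "u \<in> labelled_involutions n m" and v: "v \<in> labelled_involutions n m"
    and eq: "content n u = content n v"
  obtain \<sigma> s \<sigma>' s' where uv: "u = (\<sigma>, s)" "v = (\<sigma>', s')"
    using surj_pair[of u] surj_pair[of v] by blast
  interpret A: labelled_involution n m \<sigma> s
    using u uv by unfold_locales simp
  interpret B: labelled_involution n m \<sigma>' s'
    using v uv by unfold_locales simp
  have same_letter: "A.letter_of i = B.letter_of i" if "i \<in> {1..n}" for i
    using A.letter_of_strict_mono B.letter_of_strict_mono _ that
    by (rule enumeration_unique) (use eq uv in \<open>simp add: A.letter_of_image B.letter_of_image\<close>)
  have "s i = s' i" for i
  proof (cases "i \<in> {1..n}")
    case True
    then show ?thesis
      using same_letter by (simp add: A.letter_of_def B.letter_of_def)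
  next
    case False
    then show ?thesis
      using A.labelled B.labelled by (auto simp: labelled_involutions_def climbs_def PiE_iff extensional_def)
  qed
  moreover have "\<sigma> i = \<sigma>' i" for i
  proof (cases "i \<in> {1..n}")
    case True
    then have "A.letter_of (\<sigma> i) = A.letter_of (\<sigma>' i)"
      using same_letter A.opposite_letter_of B.opposite_letter_of B.in_range_iff by metis
    then show ?thesis
      using True A.in_range_iff B.in_range_iff inj_onD[OF bij_betw_imp_inj_on[OF A.letter_of_bij]] by metis
  next
    case False
    then show ?thesis
      using A.permutes B.permutes by (simp add: permutes_def)
  qed
  ultimately show "u = v"
    by (auto simp: uv)
qed

text \<open>
  The letters of a symmetric multiset, enumerated increasingly by \<open>g\<close>, give back a labelled
  involution: conjugate \<open>opposite\<close> by \<open>g\<close>, and take the first component as label. The lemma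
  \<open>opposite_antimono\<close> shows that \<open>\<sigma>\<close> falls wherever the label stays constant.
\<close>

lemma content_surj:
  assumes "A \<in> symmetric_multisets n m"
  shows "A \<in> content n ` labelled_involutions n m"
proof -
  have A: "set_mset A \<subseteq> {1..m} \<times> {1..m}" "size A = n" "symmetric A"
    using assms by (auto simp: symmetric_multisets_def multisets_of_size_def)
  obtain g where g: "bij_betw g {1..n} (letters A)" "strict_mono_on {1..n} g"
    using ex_enumeration[of "letters A"] by (auto simp: card_letters A(2))
  define h where "h = inv_into {1..n} g"
  have hg: "h (g i) = i" if "i \<in> {1..n}" for i
    using g(1) that by (simp add: h_def bij_betw_inv_into_left)
  have gh: "g (h x) = x" "h x \<in> {1..n}" if "x \<in> letters A" for x
    using g(1) that bij_betw_apply[OF bij_betw_inv_into[OF g(1)]]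
    by (simp_all add: h_def bij_betw_inv_into_right del: atLeastAtMost_iff)
  have g_mem: "g i \<in> letters A" if "i \<in> {1..n}" for i
    using g(1) that by (rule bij_betw_apply)
  define \<sigma> where "\<sigma> i = (if i \<in> {1..n} then h (opposite (g i)) else i)" for i
  define s where "s = (\<lambda>i\<in>{1..n}. nat (fst (g i)))"
  have \<sigma>_mem: "\<sigma> i \<in> {1..n}" and g\<sigma>: "g (\<sigma> i) = opposite (g i)" if "i \<in> {1..n}" for i
    using gh opposite_letters[OF A(3) g_mem[OF that]] that by (simp_all add: \<sigma>_def del: atLeastAtMost_iff)
  have \<sigma>\<sigma>: "\<sigma> (\<sigma> i) = i" for i
  proof (cases "i \<in> {1..n}")
    case True
    then show ?thesis
      using \<sigma>_mem g\<sigma> hg by (metis opposite_opposite)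
  next
    case False
    then have "\<sigma> i = i"
      unfolding \<sigma>_def by (rule if_not_P)
    then show ?thesis
      by simp
  qed
  have g_eq: "fst (g i) = int (s i) \<and> fst (snd (g i)) = - int (s (\<sigma> i))" if i: "i \<in> {1..n}" for i
  proof -
    have nonneg: "fst (g j) \<ge> 0" if "j \<in> {1..n}" for j
      using g_mem[OF that] by (cases "g j") (auto simp: mem_letters_iff)
    have "fst (g (\<sigma> i)) = - fst (snd (g i))"
      using g\<sigma>[OF i] by (cases "g i") simp
    then show ?thesis
      using nonneg[OF i] nonneg[OF \<sigma>_mem[OF i]] i \<sigma>_mem[OF i] by (simp add: s_def)
  qed
  have "\<sigma> permutes {1..n}"
    unfolding permutes_def
  proof (intro conjI allI impI)
    show "\<sigma> x = x" if "x \<notin> {1..n}" for x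
      unfolding \<sigma>_def using that by (rule if_not_P)
    show "\<exists>!x. \<sigma> x = y" for y
      using \<sigma>\<sigma> by metis
  qed
  moreover have "\<sigma> \<circ> \<sigma> = id"
    by (simp add: fun_eq_iff \<sigma>\<sigma>)
  moreover have "s \<in> climbs (\<lambda>i. \<sigma> i < \<sigma> (i + 1)) n m"
  proof -
    have "s i \<in> {1..m}" if i: "i \<in> {1..n}" for i
    proof -
      obtain p q r where pq: "fst (g i) = int p" and r: "r < count A (p, q)"
        using g_mem[OF i] by (cases "g i") (auto simp: mem_letters_iff)
      have "(p, q) \<in># A"
        using r by (simp flip: count_greater_zero_iff)
      with pq show ?thesis
        using g_eq[OF i] A(1) by auto
    qed
    moreover have "s i \<le> s (i + 1) \<and> (\<sigma> i < \<sigma> (i + 1) \<longrightarrow> s i < s (i + 1))" if i: "i \<in> {1..<n}" for i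
    proof -
      have ran: "i \<in> {1..n}" "i + 1 \<in> {1..n}"
        using i by auto
      have less: "g i < g (i + 1)"
        using strict_mono_onD[OF g(2) ran] by simp
      then have "s i \<le> s (i + 1)"
        using g_eq[OF ran(1)] g_eq[OF ran(2)] by (auto simp: less_prod_def)
      moreover have "\<not> \<sigma> i < \<sigma> (i + 1)" if "s i = s (i + 1)"
      proof
        assume "\<sigma> i < \<sigma> (i + 1)"
        then have "opposite (g i) < opposite (g (i + 1))"
          using strict_mono_onD[OF g(2) \<sigma>_mem[OF ran(1)] \<sigma>_mem[OF ran(2)]] g\<sigma> ran by simp
        moreover have "opposite (g (i + 1)) < opposite (g i)"
          using less that g_eq[OF ran(1)] g_eq[OF ran(2)] by (intro opposite_antimono) auto
        ultimately show False
          by simp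
      qed
      ultimately show ?thesis
        by force
    qed
    ultimately show ?thesis
      by (auto simp: climbs_def s_def)
  qed
  ultimately have "(\<sigma>, s) \<in> labelled_involutions n m"
    by (simp add: labelled_involutions_def involutions_def)
  moreover have "content n (\<sigma>, s) = A"
  proof (rule multiset_eqI)
    fix x :: "nat \<times> nat"
    obtain p q where x: "x = (p, q)"
      by (cases x)
    have "bij_betw g {i \<in> {1..n}. s i = p \<and> s (\<sigma> i) = q} (letter A ` ({(p, q)} \<times> {..<count A (p, q)}))"
    proof (rule bij_betw_imageI)
      show "inj_on g {i \<in> {1..n}. s i = p \<and> s (\<sigma> i) = q}"
        using bij_betw_imp_inj_on[OF g(1)] by (rule inj_on_subset) auto
      have "g ` {i \<in> {1..n}. s i = p \<and> s (\<sigma> i) = q} =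
          {y \<in> g ` {1..n}. fst y = int p \<and> fst (snd y) = - int q}"
        using g_eq by (auto simp del: atLeastAtMost_iff)
      also have "\<dots> = {y \<in> letters A. fst y = int p \<and> fst (snd y) = - int q}"
        using g(1) by (simp add: bij_betw_def)
      also have "\<dots> = letter A ` ({(p, q)} \<times> {..<count A (p, q)})"
        by (force simp: mem_letters_iff letter_def)
      finally show "g ` {i \<in> {1..n}. s i = p \<and> s (\<sigma> i) = q} = letter A ` ({(p, q)} \<times> {..<count A (p, q)})" .
    qed
    from bij_betw_same_card[OF this] show "count (content n (\<sigma>, s)) x = count A x"
      by (simp add: x count_content card_image inj_letter)
  qed
  ultimately show ?thesis
    by (metis image_eqI)
qed

section \<open>Counting symmetric multisets with signs\<close>

definition upper_pairs :: "nat \<Rightarrow> (nat \<times> nat) set" where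
  "upper_pairs m = {(p, q). 1 \<le> p \<and> p \<le> q \<and> q \<le> m}"

lemma upper_pairs_subset: "upper_pairs m \<subseteq> {1..m} \<times> {1..m}"
  by (auto simp: upper_pairs_def)

lemma finite_upper_pairs: "finite (upper_pairs m)"
  by (rule finite_subset[OF upper_pairs_subset]) simp

lemma card_upper_pairs: "card (upper_pairs m) = (m + 1) choose 2"
proof (induction m)
  case 0
  have "upper_pairs 0 = {}"
    by (auto simp: upper_pairs_def)
  then show ?case
    by simp
next
  case (Suc m)
  have "upper_pairs (Suc m) = upper_pairs m \<union> {1..Suc m} \<times> {Suc m}"
    by (auto simp: upper_pairs_def)
  moreover have "upper_pairs m \<inter> {1..Suc m} \<times> {Suc m} = {}"
    by (auto simp: upper_pairs_def)
  ultimately have "card (upper_pairs (Suc m)) = card (upper_pairs m) + Suc m"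
    by (simp add: card_Un_disjoint finite_upper_pairs)
  then show ?case
    using Suc.IH by (simp add: numeral_2_eq_2 One_nat_def)
qed

lemma count_image_mset_inj: "inj f \<Longrightarrow> count (image_mset f M) (f x) = count M x"
  by (induction M) (auto dest: injD)

text \<open>
  A symmetric multiset of pairs is described by its part on or above the diagonal, where the diagonal
  multiplicities are halved, and by the set \<open>S\<close> of diagonal positions with odd multiplicity.
\<close>

definition symmetrize :: "nat set \<Rightarrow> (nat \<times> nat) multiset \<Rightarrow> (nat \<times> nat) multiset" where
  "symmetrize S M = M + image_mset prod.swap M + image_mset (\<lambda>p. (p, p)) (mset_set S)"

lemma count_symmetrize:
  assumes "finite S"
  shows "count (symmetrize S M) (p, q) =
    count M (p, q) + count M (q, p) + of_bool (p = q \<and> p \<in> S)"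
proof -
  have "count (image_mset prod.swap M) (p, q) = count M (q, p)"
    using count_image_mset_inj[OF inj_swap, of M "(q, p)"] by simp
  moreover have "count (image_mset (\<lambda>p. (p, p)) (mset_set S)) (p, q) = of_bool (p = q \<and> p \<in> S)"
  proof (cases "p = q")
    case True
    have "inj (\<lambda>p :: nat. (p, p))"
      by (auto simp: inj_on_def)
    from count_image_mset_inj[OF this, of "mset_set S" p] show ?thesis
      using True assms by (simp add: count_mset_set')
  next
    case False
    then have "(p, q) \<notin> (\<lambda>p. (p, p)) ` S"
      by auto
    then show ?thesis
      using False assms by (simp add: count_eq_zero_iff)
  qed
  ultimately show ?thesis
    by (simp add: symmetrize_def)
qed

lemma size_symmetrize: "finite S \<Longrightarrow> size (symmetrize S M) = 2 * size M + card S"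
  by (simp add: symmetrize_def)

definition upper_half :: "(nat \<times> nat) multiset \<Rightarrow> (nat \<times> nat) multiset" where
  "upper_half A = Abs_multiset (\<lambda>(p, q).
    if p < q then count A (p, q) else if p = q then count A (p, p) div 2 else 0)"

lemma count_upper_half:
  "count (upper_half A) (p, q) =
    (if p < q then count A (p, q) else if p = q then count A (p, p) div 2 else 0)"
proof -
  have "finite {x. 0 < (case x of (p, q) \<Rightarrow>
      if p < q then count A (p, q) else if p = q then count A (p, p) div 2 else 0)}"
  proof (rule finite_subset)
    show "{x. 0 < (case x of (p, q) \<Rightarrow>
        if p < q then count A (p, q) else if p = q then count A (p, p) div 2 else 0)} \<subseteq> set_mset A"
      by (auto simp flip: count_greater_zero_iff split: if_splits)
  qed simp
  from count_Abs_multiset[OF this] show ?thesis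
    by (simp add: upper_half_def)
qed

lemma count_upper_0: "M \<in> multisets_of_size (upper_pairs m) j \<Longrightarrow> q < p \<Longrightarrow> count M (p, q) = 0"
  by (auto simp: multisets_of_size_def upper_pairs_def count_eq_zero_iff)

lemma symmetrize_bij:
  "bij_betw (\<lambda>(j, S, M). symmetrize S M)
    (SIGMA j:{0..n div 2}. {S. S \<subseteq> {1..m} \<and> card S = n - 2 * j} \<times> multisets_of_size (upper_pairs m) j)
    (symmetric_multisets n m)"
  (is "bij_betw ?f ?D _")
proof (rule bij_betw_byWitness[where f' = "\<lambda>A. (size (upper_half A),
      {p \<in> {1..m}. odd (count A (p, p))}, upper_half A)"])
  show "\<forall>x\<in>?D. (size (upper_half (?f x)), {p \<in> {1..m}. odd (count (?f x) (p, p))}, upper_half (?f x)) = x"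
  proof
    fix x assume "x \<in> ?D"
    then obtain j S M where x: "x = (j, S, M)" and S: "S \<subseteq> {1..m}"
      and M: "M \<in> multisets_of_size (upper_pairs m) j"
      by blast
    have fin: "finite S"
      using S by (rule finite_subset) simp
    have "upper_half (symmetrize S M) = M"
    proof (rule multiset_eqI)
      fix x
      show "count (upper_half (symmetrize S M)) x = count M x"
        using count_upper_0[OF M]
        by (cases x) (auto simp: count_upper_half count_symmetrize[OF fin])
    qed
    moreover have "{p \<in> {1..m}. odd (count (symmetrize S M) (p, p))} = S"
      using S by (auto simp: count_symmetrize[OF fin])
    ultimately show "(size (upper_half (?f x)), {p \<in> {1..m}. odd (count (?f x) (p, p))}, upper_half (?f x)) = x"
      using M by (simp add: x multisets_of_size_def)
  qed
  show "\<forall>A\<in>symmetric_multisets n m. ?f (size (upper_half A),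
      {p \<in> {1..m}. odd (count A (p, p))}, upper_half A) = A"
    and "(\<lambda>A. (size (upper_half A), {p \<in> {1..m}. odd (count A (p, p))}, upper_half A))
      ` symmetric_multisets n m \<subseteq> ?D"
  proof -
    have eq: "symmetrize {p \<in> {1..m}. odd (count A (p, p))} (upper_half A) = A"
      and mem: "upper_half A \<in> multisets_of_size (upper_pairs m) (size (upper_half A))"
      and size: "size A = n"
      if A: "A \<in> symmetric_multisets n m" for A
    proof -
      have ran: "p \<in> {1..m} \<and> q \<in> {1..m}" if "0 < count A (p, q)" for p q
        using A that by (force simp: symmetric_multisets_def multisets_of_size_def count_greater_zero_iff)
      have sym: "count A (p, q) = count A (q, p)" for p q
        using A by (simp add: symmetric_multisets_def symmetric_def)
      show "symmetrize {p \<in> {1..m}. odd (count A (p, p))} (upper_half A) = A"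
      proof (rule multiset_eqI)
        fix x :: "nat \<times> nat"
        obtain p q where x: "x = (p, q)"
          by (cases x)
        have "p \<in> {1..m}" if "odd (count A (p, p))"
          using ran[of p p] that by (cases "count A (p, p)") auto
        then have odd: "p \<in> {1..m} \<and> odd (count A (p, p)) \<longleftrightarrow> odd (count A (p, p))"
          by blast
        have half: "count A (p, p) div 2 + count A (p, p) div 2 + of_bool (odd (count A (p, p))) = count A (p, p)"
          by (cases "even (count A (p, p))") (auto elim!: evenE oddE)
        show "count (symmetrize {p \<in> {1..m}. odd (count A (p, p))} (upper_half A)) x = count A x"
          unfolding x using sym[of p q] odd half
          by (cases p q rule: linorder_cases) (auto simp: count_symmetrize count_upper_half)
      qed
      have "x \<in> upper_pairs m" if "x \<in># upper_half A" for x
      proof -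
        obtain p q where x: "x = (p, q)"
          by (cases x)
        have "p \<le> q" "0 < count A (p, q)"
          using that by (auto simp: x count_upper_half simp flip: count_greater_zero_iff split: if_splits)
        then show ?thesis
          using ran[of p q] by (auto simp: x upper_pairs_def)
      qed
      then show "upper_half A \<in> multisets_of_size (upper_pairs m) (size (upper_half A))"
        by (auto simp: multisets_of_size_def)
      show "size A = n"
        using A by (simp add: symmetric_multisets_def multisets_of_size_def)
    qed
    show "\<forall>A\<in>symmetric_multisets n m. ?f (size (upper_half A),
        {p \<in> {1..m}. odd (count A (p, p))}, upper_half A) = A"
      using eq by simp
    show "(\<lambda>A. (size (upper_half A), {p \<in> {1..m}. odd (count A (p, p))}, upper_half A))
        ` symmetric_multisets n m \<subseteq> ?D"
    proof (rule image_subsetI)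
      fix A assume A: "A \<in> symmetric_multisets n m"
      have "n = 2 * size (upper_half A) + card {p \<in> {1..m}. odd (count A (p, p))}"
        using size_symmetrize[of "{p \<in> {1..m}. odd (count A (p, p))}" "upper_half A"] eq[OF A] size[OF A]
        by simp
      then show "(size (upper_half A), {p \<in> {1..m}. odd (count A (p, p))}, upper_half A) \<in> ?D"
        using mem[OF A] by auto
    qed
  qed
  show "?f ` ?D \<subseteq> symmetric_multisets n m"
  proof (rule image_subsetI)
    fix x assume "x \<in> ?D"
    then obtain j S M where x: "x = (j, S, M)" and j: "j \<le> n div 2"
      and S: "S \<subseteq> {1..m}" "card S = n - 2 * j" and M: "M \<in> multisets_of_size (upper_pairs m) j"
      by auto
    have fin: "finite S"
      using S(1) by (rule finite_subset) simp
    have M': "set_mset M \<subseteq> {1..m} \<times> {1..m}" "size M = j"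
      using M upper_pairs_subset by (auto simp: multisets_of_size_def)
    have "set_mset (symmetrize S M) \<subseteq> {1..m} \<times> {1..m}"
      using M'(1) S(1) fin by (auto simp: symmetrize_def)
    moreover have "size (symmetrize S M) = n"
      using j S(2) M'(2) by (simp add: size_symmetrize[OF fin])
    moreover have "symmetric (symmetrize S M)"
      by (auto simp: symmetric_def count_symmetrize[OF fin])
    ultimately show "?f x \<in> symmetric_multisets n m"
      by (simp add: x symmetric_multisets_def multisets_of_size_def)
  qed
qed

text \<open>
  If \<open>A = symmetrize S M\<close>, then \<open>S\<close> is the set of odd diagonal positions, so the exponent is just
  the size \<open>j\<close> of \<open>M\<close>. What remains is a choice of \<open>n - 2 * j\<close> elements for \<open>S\<close> and a multiset of
  size \<open>j\<close> on \<open>(m + 1) choose 2\<close> pairs for \<open>M\<close>.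
\<close>

lemma signed_symmetric_multisets:
  "(\<Sum>A\<in>symmetric_multisets n m. (- 1) ^ ((n - card {p \<in> {1..m}. odd (count A (p, p))}) div 2)) =
    (\<Sum>j = 0..n div 2.
      (- 1) ^ j * int ((((m + 1) choose 2) + j - 1) choose j) * int (m choose (n - 2 * j)))"
  (is "sum ?w _ = _")
proof -
  let ?X = "\<lambda>j. {S. S \<subseteq> {1..m} \<and> card S = n - 2 * j} \<times> multisets_of_size (upper_pairs m) j"
  have fin: "finite (?X j)" for j
    using finite_upper_pairs by (intro finite_cartesian_product finite_multisets_of_size) auto
  have "sum ?w (symmetric_multisets n m) =
      (\<Sum>x\<in>(SIGMA j:{0..n div 2}. ?X j). ?w (case x of (j, S, M) \<Rightarrow> symmetrize S M))"
    by (rule sum.reindex_bij_betw[OF symmetrize_bij, symmetric])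
  also have "\<dots> = (\<Sum>x\<in>(SIGMA j:{0..n div 2}. ?X j). case x of (j, _) \<Rightarrow> (- 1) ^ j)"
  proof (rule sum.cong[OF refl])
    fix x assume "x \<in> (SIGMA j:{0..n div 2}. ?X j)"
    then obtain j S M where x: "x = (j, S, M)" and j: "j \<le> n div 2"
      and S: "S \<subseteq> {1..m}" "card S = n - 2 * j"
      by auto
    have fin: "finite S"
      using S(1) by (rule finite_subset) simp
    have "{p \<in> {1..m}. odd (count (symmetrize S M) (p, p))} = S"
      using S(1) by (auto simp: count_symmetrize[OF fin])
    moreover have "(n - (n - 2 * j)) div 2 = j"
      using j by auto
    ultimately show "?w (case x of (j, S, M) \<Rightarrow> symmetrize S M) = (case x of (j, _) \<Rightarrow> (- 1) ^ j)"
      using S(2) by (simp add: x)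
  qed
  also have "\<dots> = (\<Sum>j = 0..n div 2. \<Sum>x\<in>?X j. (- 1) ^ j)"
    by (subst sum.Sigma) (auto simp: fin split_def)
  also have "\<dots> = (\<Sum>j = 0..n div 2.
      (- 1) ^ j * int ((((m + 1) choose 2) + j - 1) choose j) * int (m choose (n - 2 * j)))"
    by (intro sum.cong refl)
      (simp add: card_cartesian_product n_subsets card_multisets_of_size finite_upper_pairs card_upper_pairs)
  finally show ?thesis .
qed

section \<open>The signed Eulerian numbers\<close>

lemma finite_involutions: "finite (involutions n)"
  by (rule finite_subset[OF _ finite_permutations[of "{1..n}"]]) (auto simp: involutions_def)

lemma signed_labelled_involutions:
  "(\<Sum>\<sigma>\<in>involutions n. sign \<sigma> * int (card (climbs (\<lambda>i. \<sigma> i < \<sigma> (i + 1)) n m))) =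
    (\<Sum>j = 0..n div 2.
      (- 1) ^ j * int ((((m + 1) choose 2) + j - 1) choose j) * int (m choose (n - 2 * j)))"
proof -
  have "(\<Sum>\<sigma>\<in>involutions n. sign \<sigma> * int (card (climbs (\<lambda>i. \<sigma> i < \<sigma> (i + 1)) n m))) =
      (\<Sum>\<sigma>\<in>involutions n. \<Sum>s\<in>climbs (\<lambda>i. \<sigma> i < \<sigma> (i + 1)) n m. sign \<sigma>)"
    by (simp add: mult.commute)
  also have "\<dots> = (\<Sum>(\<sigma>, s)\<in>labelled_involutions n m. sign \<sigma>)"
    unfolding labelled_involutions_def
    by (subst sum.Sigma) (auto simp: finite_involutions finite_climbs)
  also have "\<dots> = (\<Sum>u\<in>labelled_involutions n m.
      (- 1) ^ ((n - card {p \<in> {1..m}. odd (count (content n u) (p, p))}) div 2))"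
  proof (rule sum.cong[OF refl], clarify)
    fix \<sigma> s assume "(\<sigma>, s) \<in> labelled_involutions n m"
    then interpret labelled_involution n m \<sigma> s
      by unfold_locales
    show "sign \<sigma> = (- 1) ^ ((n - card {p \<in> {1..m}. odd (count (content n (\<sigma>, s)) (p, p))}) div 2)"
      by (rule sign_content)
  qed
  also have "\<dots> = (\<Sum>A\<in>symmetric_multisets n m.
      (- 1) ^ ((n - card {p \<in> {1..m}. odd (count A (p, p))}) div 2))"
  proof (rule sum.reindex_bij_betw[OF bij_betw_imageI[OF inj_content]])
    show "content n ` labelled_involutions n m = symmetric_multisets n m"
      using content_surj labelled_involution.content_symmetric_multisets
      by (force simp: labelled_involution_def)
  qed
  finally show ?thesis
    by (simp only: signed_symmetric_multisets)
qed

lemma fps_nth_one_minus_X_power: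
  "fps_nth ((1 - fps_X) ^ N) i = (- 1) ^ i * int (N choose i)"
proof (induction N arbitrary: i)
  case 0
  then show ?case
    by (cases i) auto
next
  case (Suc N)
  then show ?case
    by (cases i) (auto simp: left_diff_distrib algebra_simps)
qed

theorem theorem3:
  fixes n k :: nat
  assumes "n \<ge> 1" and "k \<le> n - 1"
  shows "signed_eulerian_inv n k =
    (\<Sum>m = 0..k + 1. (- 1) ^ (k + 1 - m) * int ((n + 1) choose (k + 1 - m)) *
      (\<Sum>j = 0..n div 2.
        (- 1) ^ j * int ((((m + 1) choose 2) + j - 1) choose j) * int (m choose (n - 2 * j))))"
proof -
  let ?C = "\<lambda>\<sigma>. Abs_fps (\<lambda>m. int (card (climbs (\<lambda>i. \<sigma> i < \<sigma> (i + 1)) n m)))"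
  define T where "T = (\<lambda>m. \<Sum>j = 0..n div 2.
    (- 1) ^ j * int ((((m + 1) choose 2) + j - 1) choose j) * int (m choose (n - 2 * j)))"
  have "Abs_fps T = (\<Sum>\<sigma>\<in>involutions n. fps_const (sign \<sigma>) * ?C \<sigma>)"
    by (rule fps_ext) (simp add: fps_sum_nth T_def flip: signed_labelled_involutions)
  then have "Abs_fps T * (1 - fps_X) ^ (n + 1) =
      (\<Sum>\<sigma>\<in>involutions n. fps_const (sign \<sigma>) * ((1 - fps_X) ^ (n + 1) * ?C \<sigma>))"
    by (simp add: sum_distrib_left mult_ac)
  also have "\<dots> = (\<Sum>\<sigma>\<in>involutions n. fps_const (sign \<sigma>) * fps_X ^ (ris n \<sigma> + 1))"
    by (simp only: climbs_gf[OF assms(1)] ris_def)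
  finally have "fps_nth (Abs_fps T * (1 - fps_X) ^ (n + 1)) (k + 1) =
      (\<Sum>\<sigma>\<in>involutions n. if ris n \<sigma> = k then sign \<sigma> else 0)"
    by (simp add: fps_sum_nth fps_X_power_nth if_distrib eq_commute cong: if_cong del: power_Suc)
  also have "\<dots> = signed_eulerian_inv n k"
    by (simp add: signed_eulerian_inv_def signed_eulerian_inv_poly_def coeff_sum)
  finally have "signed_eulerian_inv n k =
      (\<Sum>m = 0..k + 1. (- 1) ^ (k + 1 - m) * int ((n + 1) choose (k + 1 - m)) * T m)"
    by (simp add: fps_mult_nth fps_nth_one_minus_X_power mult.commute)
  then show ?thesis
    by (simp only: T_def)
qed

end
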